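(* Let $G$ be a semigroup (with identity). A colouring $G=C_1\cup\cdots\cup C_r$ is minimal if and only if there are a minimal system $(X,(T_g)_{g\in G})$, a point $a\in X$ and a partition $X=U_1\cup\cdots\cup U_r$ into sets with non-empty interior such that $C_i=\{g\in G:T_ga\in U_i^{\circ}\}$ for each $i=1,\dots,r$, where $U_i^\circ$ denotes the interior of $U_i$.
   Context: Semigroups are discrete and contain an identity element $e$. A topological dynamical $G$-system $(X,(T_g)_{g\in G})$ is a non-empty compact Hausdorff space $X$ with continuous maps $T_g:X\to X$ such that $T_{gh}=T_gT_h$ for all $g,h\in G$ and $T_e=\mathrm{id}_X$. A point $a\in X$ is transitive if $\{T_ga:g\in G\}$ is dense in $X$; the system is minimal if all its points are transitive. For bounded $f:G\to\mathbb{C}$, a $G$-system $(X,(T_g))$ is a Furstenberg system of $f$ if there exist $F\in C(X)$ and a transitive point $a\in X$ with $f(g)=F(T_ga)$ for all $g\in G$, and for any $x\ne y$ in $X$ there is $g\in G$ with $F(T_gx)\neq F(T_gy)$. It is unique up to topological isomorphism (equivariant homeomorphism), one realisation being the orbit closure of $f$ in $\overline{f(G)}^G$ under the right shift $R_g\big((x(u))_u\big)=(x(ug))_u$. A colouring $G=C_1\cup\cdots\cup C_r$ is a partition of $G$ into finitely many (pairwise disjoint, non-empty) cells. It is minimal if the Furstenberg system of the function $f:G\to\{1,\dots,r\}$ defined by $f(g)=i$ if and only if $g\in C_i$ is a minimal system. *)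

theory Defs
  imports "HOL-Analysis.Analysis"
begin

section \<open>Topological dynamical systems over a monoid\<close>

text \<open>The maps \<open>T g\<close> are total functions on the ambient type, so only
  their behaviour on \<^term>\<open>topspace X\<close> is constrained. The monoid carries no topology.\<close>

definition dynamical_system :: "'x topology \<Rightarrow> ('g::monoid_mult \<Rightarrow> 'x \<Rightarrow> 'x) \<Rightarrow> bool" where
  "dynamical_system X T \<longleftrightarrow>
     topspace X \<noteq> {} \<and> compact_space X \<and> Hausdorff_space X \<and>
     (\<forall>g. continuous_map X X (T g)) \<and>
     (\<forall>g h. \<forall>x\<in>topspace X. T (g * h) x = T g (T h x)) \<and>
     (\<forall>x\<in>topspace X. T 1 x = x)"

definition transitive_point :: "'x topology \<Rightarrow> ('g::monoid_mult \<Rightarrow> 'x \<Rightarrow> 'x) \<Rightarrow> 'x \<Rightarrow> bool" where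
  "transitive_point X T a \<longleftrightarrow>
     a \<in> topspace X \<and> X closure_of (range (\<lambda>g. T g a)) = topspace X"

definition minimal_system :: "'x topology \<Rightarrow> ('g::monoid_mult \<Rightarrow> 'x \<Rightarrow> 'x) \<Rightarrow> bool" where
  "minimal_system X T \<longleftrightarrow>
     dynamical_system X T \<and> (\<forall>x\<in>topspace X. transitive_point X T x)"

definition furstenberg_system ::
    "('g::monoid_mult \<Rightarrow> complex) \<Rightarrow> 'x topology \<Rightarrow> ('g \<Rightarrow> 'x \<Rightarrow> 'x) \<Rightarrow> bool" where
  "furstenberg_system f X T \<longleftrightarrow>
     dynamical_system X T \<and>
     (\<exists>F a. continuous_map X euclidean F \<and> transitive_point X T a \<and>
        (\<forall>g. f g = F (T g a)) \<and>
        (\<forall>x\<in>topspace X. \<forall>y\<in>topspace X. x \<noteq> y \<longrightarrow> (\<exists>g. F (T g x) \<noteq> F (T g y))))"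

section \<open>Colourings\<close>

definition colouring :: "nat \<Rightarrow> (nat \<Rightarrow> 'g set) \<Rightarrow> bool" where
  "colouring r C \<longleftrightarrow>
     (\<Union>i\<in>{1..r}. C i) = UNIV \<and> disjoint_family_on C {1..r} \<and> (\<forall>i\<in>{1..r}. C i \<noteq> {})"

definition colour_function :: "nat \<Rightarrow> (nat \<Rightarrow> 'g set) \<Rightarrow> 'g \<Rightarrow> complex" where
  "colour_function r C g = of_nat (THE i. i \<in> {1..r} \<and> g \<in> C i)"

text \<open>HOL cannot quantify over types, so the Furstenberg system is sought on the
  type \<^typ>\<open>'g \<Rightarrow> complex\<close>, where its realisation as an orbit closure lives. The lemmas
  \<open>furstenberg_system_orbit_space\<close> and \<open>minimal_colouring_iff\<close> below show that one always
  exists there, and that minimality may be tested on any Furstenberg system over any type.\<close>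

definition minimal_colouring :: "nat \<Rightarrow> (nat \<Rightarrow> 'g::monoid_mult set) \<Rightarrow> bool" where
  "minimal_colouring r C \<longleftrightarrow>
     (\<exists>(X :: ('g \<Rightarrow> complex) topology) T.
        furstenberg_system (colour_function r C) X T \<and> minimal_system X T)"

definition partition_with_interior :: "'x topology \<Rightarrow> nat \<Rightarrow> (nat \<Rightarrow> 'x set) \<Rightarrow> bool" where
  "partition_with_interior X r U \<longleftrightarrow>
     (\<Union>i\<in>{1..r}. U i) = topspace X \<and> disjoint_family_on U {1..r} \<and>
     (\<forall>i\<in>{1..r}. X interior_of (U i) \<noteq> {})"

section \<open>Existence and uniqueness of Furstenberg systems\<close>

definition right_shift :: "'g::monoid_mult \<Rightarrow> ('g \<Rightarrow> 'c) \<Rightarrow> 'g \<Rightarrow> 'c" where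
  "right_shift g x = (\<lambda>u. x (u * g))"

definition orbit_space :: "('g::monoid_mult \<Rightarrow> complex) \<Rightarrow> ('g \<Rightarrow> complex) topology" where
  "orbit_space f = top_of_set (closure (range (\<lambda>g. right_shift g f)))"

lemma topspace_orbit_space [simp]:
  "topspace (orbit_space f) = closure (range (\<lambda>g. right_shift g f))"
  by (simp add: orbit_space_def)

lemma Hausdorff_space_orbit_space: "Hausdorff_space (orbit_space f)"
  unfolding orbit_space_def
  by (intro Hausdorff_space_subtopology)
     (metis Hausdorff_space_euclidean Hausdorff_space_product_topology euclidean_product_topology)

lemma right_shift_mult: "right_shift (g * h) x = right_shift g (right_shift h x)"
  by (simp add: right_shift_def mult.assoc)

lemma right_shift_one [simp]: "right_shift 1 x = x"
  by (simp add: right_shift_def)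

lemma continuous_on_right_shift:
  "continuous_on S (right_shift g :: ('g::monoid_mult \<Rightarrow> complex) \<Rightarrow> _)"
  unfolding right_shift_def
  by (intro continuous_on_coordinatewise_then_product)
     (rule continuous_on_subset[OF continuous_on_product_coordinates], simp)

lemma right_shift_orbit_closure:
  assumes "x \<in> closure (range (\<lambda>g. right_shift g f))"
  shows "right_shift h x \<in> closure (range (\<lambda>g. right_shift g (f :: 'g::monoid_mult \<Rightarrow> complex)))"
proof -
  let ?O = "range (\<lambda>g. right_shift g f)"
  have "right_shift h ` closure ?O \<subseteq> closure ?O"
  proof (rule image_closure_subset)
    show "continuous_on (closure ?O) (right_shift h)"
      by (rule continuous_on_right_shift)
    show "right_shift h ` ?O \<subseteq> closure ?O"
      using closure_subset[of ?O] by (auto simp flip: right_shift_mult)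
  qed simp
  with assms show ?thesis by blast
qed

lemma compact_orbit_closure:
  assumes "bounded (range f)"
  shows "compact (closure (range (\<lambda>g. right_shift g (f :: 'g::monoid_mult \<Rightarrow> complex))))"
proof -
  let ?K = "closure (range f)"
  let ?P = "PiE (UNIV :: 'g set) (\<lambda>_. ?K)"
  have "compactin (product_topology (\<lambda>_. euclidean) UNIV) ?P"
    using assms by (simp add: compactin_PiE compact_closure)
  then have P: "compact ?P"
    by (simp add: euclidean_product_topology)
  have "closedin (product_topology (\<lambda>_. euclidean) UNIV) ?P"
    by (simp add: closedin_product_topology)
  then have "closed ?P"
    by (simp add: euclidean_product_topology)
  moreover have "range (\<lambda>g. right_shift g f) \<subseteq> ?P"
    using closure_subset[of "range f"] by (auto simp: right_shift_def)
  ultimately have "closure (range (\<lambda>g. right_shift g f)) \<subseteq> ?P"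
    by (rule closure_minimal[rotated])
  then show ?thesis
    using P by (metis closed_closure closure_closed compact_Int_closed inf.absorb_iff2)
qed

lemma furstenberg_system_orbit_space:
  fixes f :: "'g::monoid_mult \<Rightarrow> complex"
  assumes "bounded (range f)"
  shows "furstenberg_system f (orbit_space f) right_shift"
proof -
  let ?O = "range (\<lambda>g. right_shift g f)"
  have f: "f \<in> closure ?O"
    using closure_subset[of ?O] right_shift_one[of f] by (metis rangeI subsetD)
  have ds: "dynamical_system (orbit_space f) right_shift"
    unfolding dynamical_system_def
  proof (intro conjI allI ballI)
    show "topspace (orbit_space f) \<noteq> {}" by simp
    show "compact_space (orbit_space f)"
      using compact_orbit_closure[OF assms] by (simp add: orbit_space_def compact_space_subtopology)
    show "Hausdorff_space (orbit_space f)" by (rule Hausdorff_space_orbit_space)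
    show "continuous_map (orbit_space f) (orbit_space f) (right_shift g)" for g
      unfolding orbit_space_def
      by (auto simp: continuous_map_in_subtopology continuous_on_right_shift
          intro: right_shift_orbit_closure)
  qed (simp_all add: right_shift_mult)
  have tr: "transitive_point (orbit_space f) right_shift f"
    unfolding transitive_point_def
    using f closure_subset[of ?O]
    by (auto simp: orbit_space_def closure_of_subtopology Int_absorb1)
  have "continuous_map (orbit_space f) euclidean (\<lambda>x. x 1)"
    unfolding orbit_space_def
    by (simp add: continuous_on_subset[OF continuous_on_product_coordinates])
  moreover have "\<exists>g. right_shift g x 1 \<noteq> right_shift g y 1" if "x \<noteq> y" for x y :: "'g \<Rightarrow> complex"
    using that by (auto simp: right_shift_def fun_eq_iff)
  ultimately show ?thesis
    unfolding furstenberg_system_def using ds tr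
    by (intro conjI exI[of _ "\<lambda>x. x 1"] exI[of _ f]) (auto simp: right_shift_def)
qed

lemma furstenberg_system_unique:
  fixes f :: "'g::monoid_mult \<Rightarrow> complex"
  assumes "furstenberg_system f X T"
  obtains \<phi> where "homeomorphic_map X (orbit_space f) \<phi>"
    and "\<And>g x. x \<in> topspace X \<Longrightarrow> \<phi> (T g x) = right_shift g (\<phi> x)"
proof -
  obtain F a where ds: "dynamical_system X T" and F: "continuous_map X euclidean F"
    and a: "transitive_point X T a" and fF: "\<And>g. f g = F (T g a)"
    and sep: "\<And>x y. x \<in> topspace X \<Longrightarrow> y \<in> topspace X \<Longrightarrow> x \<noteq> y \<Longrightarrow> \<exists>g. F (T g x) \<noteq> F (T g y)"
    using assms unfolding furstenberg_system_def by blast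
  define \<phi> where "\<phi> = (\<lambda>x g. F (T g x))"
  let ?O = "range (\<lambda>g. right_shift g f)"
  have aX: "a \<in> topspace X" using a by (simp add: transitive_point_def)
  have T: "continuous_map X X (T g)" for g
    using ds by (simp add: dynamical_system_def)
  have eq: "\<phi> (T g x) = right_shift g (\<phi> x)" if "x \<in> topspace X" for g x
    using ds that by (auto simp: \<phi>_def right_shift_def dynamical_system_def)
  have \<phi>a: "\<phi> a = f" by (auto simp: \<phi>_def fF)
  have "continuous_map X (product_topology (\<lambda>_. euclidean) UNIV) \<phi>"
    using continuous_map_compose[OF T F]
    by (auto simp: continuous_map_componentwise_UNIV \<phi>_def o_def)
  then have cont: "continuous_map X euclidean \<phi>"
    by (simp add: euclidean_product_topology)
  have orb: "\<phi> ` range (\<lambda>g. T g a) = ?O"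
    using eq[OF aX] by (auto simp: \<phi>a image_image)
  have sub: "\<phi> ` topspace X \<subseteq> closure ?O"
    using continuous_map_image_closure_subset[OF cont, of "range (\<lambda>g. T g a)"] a orb
    by (simp add: transitive_point_def)
  have c: "continuous_map X (orbit_space f) \<phi>"
    using cont sub by (auto simp: orbit_space_def continuous_map_in_subtopology)
  have "compactin (orbit_space f) (\<phi> ` topspace X)"
    using ds by (intro image_compactin[OF _ c]) (simp add: dynamical_system_def compact_space_def)
  then have "closedin (orbit_space f) (\<phi> ` topspace X)"
    by (rule compactin_imp_closedin[OF Hausdorff_space_orbit_space])
  then have "closed (\<phi> ` topspace X)"
    unfolding orbit_space_def using closedin_closed_trans closed_closure by blast
  moreover have "?O \<subseteq> \<phi> ` topspace X"
    using orb T aX by (auto simp: continuous_map_def Pi_iff simp flip: orb)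
  ultimately have "closure ?O \<subseteq> \<phi> ` topspace X"
    by (simp add: closure_minimal)
  with sub have im: "\<phi> ` topspace X = topspace (orbit_space f)" by simp
  have inj: "inj_on \<phi> (topspace X)"
    using sep by (force simp: inj_on_def \<phi>_def fun_eq_iff)
  have "homeomorphic_map X (orbit_space f) \<phi>"
    using ds by (intro continuous_imp_homeomorphic_map c im inj Hausdorff_space_orbit_space)
      (simp add: dynamical_system_def)
  then show thesis using eq that by blast
qed

lemma minimal_system_orbit_space_iff:
  fixes f :: "'g::monoid_mult \<Rightarrow> complex"
  assumes f: "furstenberg_system f X T"
  shows "minimal_system X T \<longleftrightarrow> (\<forall>y\<in>topspace (orbit_space f).
    transitive_point (orbit_space f) right_shift y)"
proof -
  obtain \<phi> where h: "homeomorphic_map X (orbit_space f) \<phi>"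
    and eq: "\<And>g x. x \<in> topspace X \<Longrightarrow> \<phi> (T g x) = right_shift g (\<phi> x)"
    using furstenberg_system_unique[OF f] by metis
  have ds: "dynamical_system X T" using f by (simp add: furstenberg_system_def)
  have im: "\<phi> ` topspace X = topspace (orbit_space f)"
    by (rule homeomorphic_imp_surjective_map[OF h])
  have inj: "inj_on \<phi> (topspace X)"
    by (rule homeomorphic_imp_injective_map[OF h])
  have "transitive_point X T x \<longleftrightarrow> transitive_point (orbit_space f) right_shift (\<phi> x)"
    if x: "x \<in> topspace X" for x
  proof -
    let ?O = "range (\<lambda>g. T g x)"
    have O: "?O \<subseteq> topspace X"
      using ds x by (auto simp: dynamical_system_def continuous_map_def Pi_iff)
    have "range (\<lambda>g. right_shift g (\<phi> x)) = \<phi> ` ?O"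
      using eq[OF x] by (simp add: image_image)
    then have "orbit_space f closure_of range (\<lambda>g. right_shift g (\<phi> x)) = \<phi> ` (X closure_of ?O)"
      using homeomorphic_map_closure_of[OF h O] by simp
    moreover have "\<phi> ` (X closure_of ?O) = \<phi> ` topspace X \<longleftrightarrow> X closure_of ?O = topspace X"
      by (rule inj_on_image_eq_iff[OF inj closure_of_subset_topspace]) simp
    moreover have "\<phi> x \<in> topspace (orbit_space f)"
      using x im by blast
    ultimately show ?thesis
      using x im unfolding transitive_point_def by simp
  qed
  then show ?thesis
    using ds unfolding minimal_system_def im[symmetric] by blast
qed

lemma bounded_colour_function:
  assumes "colouring r C"
  shows "bounded (range (colour_function r C))"
proof -
  have "colour_function r C g \<in> of_nat ` {1..r}" for g
  proof -
    obtain i where i: "i \<in> {1..r}" "g \<in> C i"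
      using assms unfolding colouring_def by blast
    moreover have "j = i" if "j \<in> {1..r} \<and> g \<in> C j" for j
      using assms i that unfolding colouring_def disjoint_family_on_def by blast
    ultimately have "(THE i. i \<in> {1..r} \<and> g \<in> C i) = i"
      by (intro the_equality) auto
    with i show ?thesis by (auto simp: colour_function_def)
  qed
  then show ?thesis
    by (meson bounded_subset finite_atLeastAtMost finite_imageI finite_imp_bounded image_subsetI)
qed

lemma minimal_colouring_iff:
  fixes C :: "nat \<Rightarrow> 'a::monoid_mult set"
  assumes "colouring r C" and "furstenberg_system (colour_function r C) X T"
  shows "minimal_colouring r C \<longleftrightarrow> minimal_system X T"
proof
  assume "minimal_colouring r C"
  then obtain Y :: "('a \<Rightarrow> complex) topology" and S
    where "furstenberg_system (colour_function r C) Y S" "minimal_system Y S"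
    unfolding minimal_colouring_def by blast
  then show "minimal_system X T"
    using minimal_system_orbit_space_iff[OF assms(2)] minimal_system_orbit_space_iff by blast
next
  assume "minimal_system X T"
  moreover have o: "furstenberg_system (colour_function r C)
      (orbit_space (colour_function r C)) right_shift"
    by (rule furstenberg_system_orbit_space[OF bounded_colour_function[OF assms(1)]])
  ultimately have "minimal_system (orbit_space (colour_function r C)) right_shift"
    using minimal_system_orbit_space_iff[OF assms(2)] minimal_system_orbit_space_iff[OF o] by blast
  with o show "minimal_colouring r C"
    unfolding minimal_colouring_def by blast
qed

end

theory Submission
  imports Defs
begin

text \<open>The orbit closure of the colour function \<open>f\<close> is minimal as soon as \<open>f\<close> is uniformly
  recurrent: for every finite \<open>F\<close> there is a finite \<open>H\<close> such that each \<open>g\<close> admits an \<open>h \<in> H\<close>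
  with \<open>f (u h g) = f u\<close> on \<open>F\<close>. If the cells are the sets of return times of \<open>a\<close> to open sets
  \<open>V i\<close>, let \<open>W\<close> be the open set of the \<open>x\<close> with \<open>T u x \<in> V (f u)\<close> for all \<open>u \<in> F\<close>. It
  contains \<open>a\<close>, so by minimality and compactness the preimages of \<open>W\<close> under finitely many \<open>T h\<close>
  cover the space, and these \<open>h\<close> form \<open>H\<close>. Conversely, in the orbit closure of \<open>f\<close> the sets
  \<open>{x. x 1 = i}\<close> form a clopen partition that reads off \<open>f\<close> along its own orbit.\<close>

text \<open>A basic neighbourhood in the product topology constrains finitely many coordinates, so
  one tolerance serves them all. This turns membership in an orbit closure into a finite
  approximation condition.\<close>

lemma closure_fun_iff:
  fixes x :: "'i \<Rightarrow> 'b::metric_space"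
  shows "x \<in> closure S \<longleftrightarrow> (\<forall>F e. finite F \<longrightarrow> 0 < e \<longrightarrow> (\<exists>s\<in>S. \<forall>u\<in>F. dist (s u) (x u) < e))"
proof (intro iffI allI impI)
  fix F :: "'i set" and e :: real
  assume x: "x \<in> closure S" and F: "finite F" "0 < e"
  let ?V = "\<lambda>u. {z :: 'i \<Rightarrow> 'b. z u \<in> ball (x u) e}"
  have "open (?V u)" for u
    using open_vimage[OF open_ball continuous_on_product_coordinates[of u]]
    by (auto simp: vimage_def)
  then have "open (\<Inter>u\<in>F. ?V u)"
    using F by (intro open_INT) auto
  moreover have "x \<in> (\<Inter>u\<in>F. ?V u)"
    using F by simp
  ultimately obtain s where "s \<in> S" "s \<in> (\<Inter>u\<in>F. ?V u)"
    using x open_Int_closure_eq_empty[of "\<Inter>u\<in>F. ?V u" S] by blast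
  then show "\<exists>s\<in>S. \<forall>u\<in>F. dist (s u) (x u) < e"
    by (auto simp: dist_commute)
next
  assume R: "\<forall>F e. finite F \<longrightarrow> 0 < e \<longrightarrow> (\<exists>s\<in>S. \<forall>u\<in>F. dist (s u) (x u) < e)"
  have "S \<inter> V \<noteq> {}" if V: "open V" "x \<in> V" for V
  proof -
    have "openin (product_topology (\<lambda>_. euclidean) UNIV) V"
      using V(1) by (simp add: euclidean_product_topology)
    then obtain B where B: "x \<in> PiE UNIV B" "\<And>u. open (B u)"
      "finite {u. B u \<noteq> UNIV}" "PiE UNIV B \<subseteq> V"
      using product_topology_open_contains_basis[of "\<lambda>_. euclidean" UNIV V x] V(2) by auto
    let ?F = "{u. B u \<noteq> UNIV}"
    have "\<forall>u. \<exists>e>0. ball (x u) e \<subseteq> B u"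
      using B(1,2) by (metis PiE_mem UNIV_I open_contains_ball)
    then obtain e where e: "\<And>u. 0 < e u" "\<And>u. ball (x u) (e u) \<subseteq> B u"
      by metis
    \<comment> \<open>The inserted \<open>1\<close> keeps \<open>Min\<close> meaningful when no
      coordinate is constrained.\<close>
    define d where "d = Min (insert 1 (e ` ?F))"
    have "0 < d" using B(3) e(1) by (auto simp: d_def)
    then obtain s where s: "s \<in> S" "\<And>u. u \<in> ?F \<Longrightarrow> dist (s u) (x u) < d"
      using R B(3) by meson
    have "s u \<in> B u" for u
    proof (cases "u \<in> ?F")
      case True
      then have "d \<le> e u" using B(3) by (auto simp: d_def)
      with s(2)[OF True] e(2)[of u] show ?thesis by (auto simp: dist_commute)
    qed auto
    then have "s \<in> V" using B(4) by auto
    with s(1) show ?thesis by blast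
  qed
  \<comment> \<open>If \<open>x\<close> were outside the closure, the complement would be an open
    neighbourhood of \<open>x\<close> missing \<open>S\<close>.\<close>
  from this[of "- closure S"] show "x \<in> closure S"
    using closure_subset[of S] by auto
qed

text \<open>A point \<open>y\<close> of the orbit closure is approximated by shifts of
  \<open>f\<close>; recurrence then moves \<open>y\<close> close to \<open>f\<close> by a further
  shift. So \<open>f\<close> lies in the orbit closure of \<open>y\<close>, and the two closures
  coincide.\<close>

lemma minimal_system_orbit_spaceI:
  fixes f :: "'g::monoid_mult \<Rightarrow> complex"
  assumes bdd: "bounded (range f)"
    and rec: "\<And>F. finite F \<Longrightarrow> \<exists>H. finite H \<and> (\<forall>g. \<exists>h\<in>H. \<forall>u\<in>F. f (u * h * g) = f u)"
  shows "minimal_system (orbit_space f) right_shift"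
proof -
  let ?O = "\<lambda>y. range (\<lambda>g. right_shift g (y :: 'g \<Rightarrow> complex))"
  have "transitive_point (orbit_space f) right_shift y" if y: "y \<in> closure (?O f)" for y
  proof -
    have "f \<in> closure (?O y)"
      unfolding closure_fun_iff
    proof (intro allI impI)
      fix F :: "'g set" and e :: real
      assume F: "finite F" and e: "0 < e"
      obtain H where H: "finite H" "\<And>g. \<exists>h\<in>H. \<forall>u\<in>F. f (u * h * g) = f u"
        using rec[OF F] by blast
      \<comment> \<open>The suitable \<open>h\<close> depends on \<open>g\<close>, which is chosen
        first, so \<open>g\<close> must approximate \<open>y\<close> at all products
        \<open>u * h\<close> at once. Finiteness of \<open>H\<close> permits this.\<close>
      have "finite ((\<lambda>(u, h). u * h) ` (F \<times> H))"
        using F H(1) by simp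
      then obtain g where g: "\<And>u h. u \<in> F \<Longrightarrow> h \<in> H \<Longrightarrow> dist (f (u * h * g)) (y (u * h)) < e"
        using y e unfolding closure_fun_iff right_shift_def by fastforce
      obtain h where "h \<in> H" "\<forall>u\<in>F. f (u * h * g) = f u"
        using H(2) by blast
      then have "\<forall>u\<in>F. dist (right_shift h y u) (f u) < e"
        using g by (metis right_shift_def dist_commute)
      then show "\<exists>s\<in>?O y. \<forall>u\<in>F. dist (s u) (f u) < e" by blast
    qed
    then have "?O f \<subseteq> closure (?O y)"
      using right_shift_orbit_closure by blast
    then have "closure (?O f) \<subseteq> closure (?O y)"
      by (simp add: closure_minimal)
    moreover have "?O y \<subseteq> closure (?O f)"
      using y right_shift_orbit_closure by blast
    ultimately show ?thesis
      using y unfolding transitive_point_def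
      by (auto simp: orbit_space_def closure_of_subtopology Int_absorb1)
  qed
  then show ?thesis
    using furstenberg_system_orbit_space[OF bdd]
    by (simp add: minimal_system_def furstenberg_system_def)
qed

text \<open>Every orbit is dense and so meets \<open>W\<close>. Applied along an orbit, the lemma
  says that the times of visit to \<open>W\<close> form a syndetic set.\<close>

lemma minimal_system_finite_hitting:
  fixes T :: "'g::monoid_mult \<Rightarrow> 'x \<Rightarrow> 'x"
  assumes X: "minimal_system X T" and W: "openin X W" "W \<noteq> {}"
  obtains H where "finite H" "\<And>x. x \<in> topspace X \<Longrightarrow> \<exists>h\<in>H. T h x \<in> W"
proof -
  let ?P = "\<lambda>h. {x \<in> topspace X. T h x \<in> W}"
  have "openin X (?P h)" for h
    using X W(1) unfolding minimal_system_def dynamical_system_def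
    by (auto intro: openin_continuous_map_preimage)
  moreover have "topspace X \<subseteq> \<Union> (range ?P)"
  proof
    fix x assume x: "x \<in> topspace X"
    obtain w where "w \<in> W" using W(2) by blast
    moreover from this have "w \<in> X closure_of range (\<lambda>h. T h x)"
      using X x openin_subset[OF W(1)] by (auto simp: minimal_system_def transitive_point_def)
    ultimately obtain h where "T h x \<in> W"
      using W(1) by (auto simp: in_closure_of)
    with x show "x \<in> \<Union> (range ?P)" by blast
  qed
  moreover have "compactin X (topspace X)"
    using X by (simp add: minimal_system_def dynamical_system_def compact_space_def)
  ultimately obtain \<F> where \<F>: "finite \<F>" "\<F> \<subseteq> range ?P" "topspace X \<subseteq> \<Union>\<F>"
    using compactinD[of X "topspace X" "range ?P"] by blast
  then obtain H where "finite H" "\<F> = ?P ` H"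
    by (meson finite_subset_image)
  with \<F>(3) that show thesis by blast
qed

lemma colour_function_eq_iff:
  assumes "colouring r C" "i \<in> {1..r}"
  shows "colour_function r C g = of_nat i \<longleftrightarrow> g \<in> C i"
proof -
  obtain j where j: "j \<in> {1..r}" "g \<in> C j"
    using assms(1) unfolding colouring_def by blast
  have eq: "k = j" if "k \<in> {1..r}" "g \<in> C k" for k
    using assms(1) j that unfolding colouring_def disjoint_family_on_def by blast
  have "(THE k. k \<in> {1..r} \<and> g \<in> C k) = j"
    by (rule the_equality) (use j eq in blast)+
  then have "colour_function r C g = of_nat j"
    by (simp add: colour_function_def)
  then show ?thesis
    using eq[OF assms(2)] j by auto
qed

lemma colour_function_in_range:
  assumes "colouring r C"
  shows "colour_function r C g \<in> of_nat ` {1..r}"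
  using assms colour_function_eq_iff[OF assms, of _ g] unfolding colouring_def by blast

text \<open>Openness of the \<open>V i\<close> makes "has the colours of \<open>a\<close> at all
  times in \<open>F\<close>" an open condition on points, so syndetic returns to it give uniform
  recurrence of the colour function.\<close>

lemma minimal_colouring_if_return_times:
  fixes C :: "nat \<Rightarrow> 'g::monoid_mult set" and X :: "'x topology"
  assumes C: "colouring r C" and X: "minimal_system X T" and a: "a \<in> topspace X"
    and V: "\<And>i. i \<in> {1..r} \<Longrightarrow> openin X (V i)"
    and CV: "\<And>i. i \<in> {1..r} \<Longrightarrow> C i = {g. T g a \<in> V i}"
  shows "minimal_colouring r C"
proof -
  let ?f = "colour_function r C"
  note fs = furstenberg_system_orbit_space[OF bounded_colour_function[OF C]]
  have ds: "continuous_map X X (T g)" "x \<in> topspace X \<Longrightarrow> T (g * h) x = T g (T h x)" for g h x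
    using X by (auto simp: minimal_system_def dynamical_system_def)
  have Ta: "T g a \<in> topspace X" for g
    using ds(1) a by (auto simp: continuous_map_def)
  obtain c where c: "\<And>g. c g \<in> {1..r}" "\<And>g. ?f g = of_nat (c g)"
  proof -
    have "\<forall>g. \<exists>i. i \<in> {1..r} \<and> ?f g = of_nat i"
      using colour_function_in_range[OF C] by blast
    then show thesis using that by metis
  qed
  have f_eq: "?f g = ?f u \<longleftrightarrow> T g a \<in> V (c u)" for g u
    using colour_function_eq_iff[OF C c(1)[of u], of g] CV[OF c(1)] by (simp add: c(2)[of u])
  have "minimal_system (orbit_space ?f) right_shift"
  proof (rule minimal_system_orbit_spaceI[OF bounded_colour_function[OF C]])
    fix F :: "'g set" assume F: "finite F"
    \<comment> \<open>The factor \<open>topspace X\<close> handles empty \<open>F\<close>, where the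
      intersection is the whole type.\<close>
    define W where "W = topspace X \<inter> (\<Inter>u\<in>F. {x \<in> topspace X. T u x \<in> V (c u)})"
    have "openin X W"
      unfolding W_def using F ds(1) V c(1)
      by (cases "F = {}") (auto intro!: openin_Int openin_INT2 openin_continuous_map_preimage)
    moreover have "a \<in> W"
      using a f_eq by (auto simp: W_def)
    ultimately obtain H where H: "finite H" "\<And>x. x \<in> topspace X \<Longrightarrow> \<exists>h\<in>H. T h x \<in> W"
      using minimal_system_finite_hitting[OF X] by blast
    have "\<exists>h\<in>H. \<forall>u\<in>F. ?f (u * h * g) = ?f u" for g
    proof -
      obtain h where h: "h \<in> H" "T h (T g a) \<in> W"
        using H(2)[OF Ta] by blast
      then have "T (u * h * g) a \<in> V (c u)" if "u \<in> F" for u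
        using that by (simp add: W_def ds(2) a Ta mult.assoc)
      with h(1) f_eq show ?thesis by blast
    qed
    with H(1) show "\<exists>H. finite H \<and> (\<forall>g. \<exists>h\<in>H. \<forall>u\<in>F. ?f (u * h * g) = ?f u)"
      by blast
  qed
  with fs show ?thesis
    unfolding minimal_colouring_def by blast
qed

lemma orbit_closure_values:
  fixes f :: "'g::monoid_mult \<Rightarrow> complex"
  assumes "x \<in> closure (range (\<lambda>g. right_shift g f))" "closed S" "range f \<subseteq> S"
  shows "x u \<in> S"
proof -
  have "closed ((\<lambda>x :: 'g \<Rightarrow> complex. x u) -` S)"
    using closed_vimage[OF assms(2) continuous_on_product_coordinates] .
  moreover have "range (\<lambda>g. right_shift g f) \<subseteq> (\<lambda>x. x u) -` S"
    using assms(3) by (auto simp: right_shift_def)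
  ultimately show ?thesis
    using assms(1) closure_minimal by blast
qed

text \<open>The coordinate at \<open>1\<close> recovers the colouring, since
  \<open>right_shift g f\<close> takes the value \<open>f g\<close> there.\<close>

lemma minimal_colouring_realisation:
  fixes C :: "nat \<Rightarrow> 'g::monoid_mult set"
  assumes C: "colouring r C" and min: "minimal_colouring r C"
  defines "f \<equiv> colour_function r C"
  defines "U \<equiv> \<lambda>i. {x \<in> topspace (orbit_space f). x 1 = of_nat i}"
  shows "minimal_system (orbit_space f) right_shift" "f \<in> topspace (orbit_space f)"
    "partition_with_interior (orbit_space f) r U"
    "\<And>i. i \<in> {1..r} \<Longrightarrow> C i = {g. right_shift g f \<in> orbit_space f interior_of (U i)}"
proof -
  let ?X = "orbit_space f"
  show "minimal_system ?X right_shift"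
    using min minimal_colouring_iff[OF C furstenberg_system_orbit_space[OF bounded_colour_function[OF C]]]
    by (simp add: f_def)
  have orb: "right_shift g f \<in> topspace ?X" for g
    using closure_subset by fastforce
  from this[of 1] show "f \<in> topspace ?X" by simp
  \<comment> \<open>The set of colours is finite, hence closed, so limits of shifts of
    \<open>f\<close> still take colours as values.\<close>
  have vals: "x 1 \<in> of_nat ` {1..r}" if "x \<in> topspace ?X" for x
  proof (rule orbit_closure_values[of x f])
    show "x \<in> closure (range (\<lambda>g. right_shift g f))" using that by simp
    show "range f \<subseteq> of_nat ` {1..r}"
      using colour_function_in_range[OF C] unfolding f_def by blast
  qed (simp add: finite_imp_closed)
  have "openin ?X (U i)" for i
  proof -
    \<comment> \<open>Fixing a value is visibly a closed condition; it is open here because it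
      amounts to avoiding the finitely many other colours.\<close>
    let ?N = "- (of_nat ` ({1..r} - {i})) :: complex set"
    have "open ((\<lambda>x :: 'g \<Rightarrow> complex. x 1) -` ?N)"
      by (intro open_vimage continuous_on_product_coordinates)
        (simp add: finite_imp_closed open_Compl)
    moreover have "U i = topspace ?X \<inter> (\<lambda>x. x 1) -` ?N"
      using vals unfolding U_def by fastforce
    ultimately show ?thesis
      by (simp add: orbit_space_def openin_open_Int)
  qed
  then have int: "?X interior_of (U i) = U i" for i
    by (simp add: interior_of_openin)
  have mem: "right_shift g f \<in> U i \<longleftrightarrow> g \<in> C i" if "i \<in> {1..r}" for g i
    using colour_function_eq_iff[OF C that, of g] orb[of g]
    unfolding U_def f_def by (simp add: right_shift_def)
  then show "\<And>i. i \<in> {1..r} \<Longrightarrow> C i = {g. right_shift g f \<in> ?X interior_of (U i)}"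
    by (simp add: int)
  \<comment> \<open>Any \<open>g\<close> in the non-empty cell \<open>C i\<close> yields the point
    \<open>right_shift g f\<close> of \<open>U i\<close>.\<close>
  have "U i \<noteq> {}" if "i \<in> {1..r}" for i
    using mem[OF that] C that unfolding colouring_def by blast
  moreover have "(\<Union>i\<in>{1..r}. U i) = topspace ?X"
    using vals unfolding U_def by blast
  moreover have "disjoint_family_on U {1..r}"
    by (auto simp: disjoint_family_on_def U_def)
  ultimately show "partition_with_interior ?X r U"
    by (simp add: partition_with_interior_def int)
qed

text \<open>An existential cannot range over types, so the equivalence is stated on the type
  carrying the orbit closure; the second conjunct gives sufficiency for systems on an arbitrary
  type.\<close>

theorem theorem4p8:
  fixes r :: nat and C :: "nat \<Rightarrow> 'g::monoid_mult set"
  assumes "colouring r C"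
  shows "(minimal_colouring r C \<longleftrightarrow>
           (\<exists>(X :: ('g \<Rightarrow> complex) topology) T a U.
              minimal_system X T \<and> a \<in> topspace X \<and> partition_with_interior X r U \<and>
              (\<forall>i\<in>{1..r}. C i = {g. T g a \<in> X interior_of (U i)}))) \<and>
         (\<forall>(X :: 'x topology) T a U.
            minimal_system X T \<and> a \<in> topspace X \<and> partition_with_interior X r U \<and>
            (\<forall>i\<in>{1..r}. C i = {g. T g a \<in> X interior_of (U i)})
            \<longrightarrow> minimal_colouring r C)"
proof (intro conjI iffI allI impI)
  assume "minimal_colouring r C"
  from minimal_colouring_realisation[OF assms this]
  show "\<exists>(X :: ('g \<Rightarrow> complex) topology) T a U.
      minimal_system X T \<and> a \<in> topspace X \<and> partition_with_interior X r U \<and>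
      (\<forall>i\<in>{1..r}. C i = {g. T g a \<in> X interior_of (U i)})"
    by blast
next
  assume "\<exists>(X :: ('g \<Rightarrow> complex) topology) T a U.
      minimal_system X T \<and> a \<in> topspace X \<and> partition_with_interior X r U \<and>
      (\<forall>i\<in>{1..r}. C i = {g. T g a \<in> X interior_of (U i)})"
  then obtain X :: "('g \<Rightarrow> complex) topology" and T a U where
    "minimal_system X T" "a \<in> topspace X"
    "\<And>i. i \<in> {1..r} \<Longrightarrow> C i = {g. T g a \<in> X interior_of (U i)}"
    by blast
  then show "minimal_colouring r C"
    by (rule minimal_colouring_if_return_times[OF assms _ _ openin_interior_of])
next
  fix X :: "'x topology" and T a U
  assume "minimal_system X T \<and> a \<in> topspace X \<and> partition_with_interior X r U \<and>
    (\<forall>i\<in>{1..r}. C i = {g. T g a \<in> X interior_of (U i)})"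
  then show "minimal_colouring r C"
    by (intro minimal_colouring_if_return_times[OF assms, of X T a "\<lambda>i. X interior_of (U i)"]) auto
qed

end
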